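(* Let $p\geq 3$ be an odd prime, let $n\geq 2$ be an integer, and let $\zeta_p:\{\xi\in\mathbb{Z}:\gcd(\xi,p)=1\}\to\{0,1\}$ be a function such that (1) if $\gcd(\theta_1,p)=\gcd(\theta_2,p)=1$ and $\theta_1\equiv\theta_2\pmod p$, then $\zeta_p(\theta_1)=\zeta_p(\theta_2)$; and (2) the sets $A_i=\{a:\zeta_p(a)=i,\ 1\leq a\leq p-1\}$, $i=0,1$, satisfy $|A_0|=|A_1|=\frac{p-1}{2}$. Suppose that $\zeta_p(1)=1$ and let $S=\{1,2,\ldots,np\}$. Then the alternate cycle snake graph $A_n(C_p)$ is an arithmetic cordial graph modulo $p$ under $\langle S,\zeta_p,+\rangle$, where $+$ is ordinary addition of integers.
   Context: Alternate cycle snake graph: $A_n(C_m)$ is the graph of order $nm$ obtained from $n$ disjoint cycles $C_m^1,\ldots,C_m^n$ of order $m$, where $C_m^i$ has vertices $v_1^i,v_2^i,\ldots,v_m^i$ in cyclic order (so $v_k^i$ is adjacent to $v_{k+1}^i$ for $1\leq k\leq m-1$ and $v_m^i$ is adjacent to $v_1^i$), by adding the edges $v_m^jv_1^{j+1}$ for $j=1,2,\ldots,n-1$. Arithmetic cordial graph: let $\eta$ be a positive integer, $S\subseteq\mathbb{Z}$, $\star:S\times S\to\mathbb{Z}$ a binary function, and $\zeta_\eta:\{\xi\in\mathbb{Z}:\gcd(\xi,\eta)=1\}\to\{0,1\}$ a function. The triple $\langle S,\zeta_\eta,\star\rangle$ is called an arithmetic structure. For a simple connected graph $G$ of order $N$,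 a bijection $f:V(G)\to S$ (where $|S|=N$) is an arithmetic cordial labeling modulo $\eta$ under $\langle S,\zeta_\eta,\star\rangle$ if the induced function $f_\eta^*:E(G)\to\{0,1\}$, defined by $f_\eta^*(ab)=0$ if $\gcd(f(a)\star f(b),\eta)\neq 1$ or $\zeta_\eta(f(a)\star f(b))=0$, and $f_\eta^*(ab)=1$ if $\gcd(f(a)\star f(b),\eta)=1$ and $\zeta_\eta(f(a)\star f(b))=1$, satisfies $|e_{f_\eta^*}(0)-e_{f_\eta^*}(1)|\leq 1$, where $e_{f_\eta^*}(i)$ is the number of edges with label $i$. A graph admitting such a labeling is an arithmetic cordial graph modulo $\eta$ under $\langle S,\zeta_\eta,\star\rangle$. *)

theory Defs
  imports
    "HOL-Computational_Algebra.Primes"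
    "HOL-Number_Theory.Cong"
    "Graph_Theory.Graph_Theory"
begin

text \<open>
  Undirected graphs are symmetric digraphs whose arcs are ordered pairs of vertices; finite simple
  graphs are those satisfying \<^const>\<open>pair_graph\<close>. Each undirected edge is represented by two arcs.
\<close>

text \<open>The vertex \<open>(i, k)\<close> stands for the \<open>k\<close>-th vertex of the \<open>i\<close>-th cycle. The definition is meant
  for \<open>m \<ge> 3\<close>; the three sets are the paths and the closing edges of the cycles, and the links.\<close>

definition alternate_cycle_snake :: "nat \<Rightarrow> nat \<Rightarrow> (nat \<times> nat) pair_pre_digraph" where
  "alternate_cycle_snake n m =
    (let A = {((i, k), (i, k + 1)) | i k. 1 \<le> i \<and> i \<le> n \<and> 1 \<le> k \<and> k \<le> m - 1}
           \<union> {((i, m), (i, 1)) | i. 1 \<le> i \<and> i \<le> n}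
           \<union> {((j, m), (j + 1, 1)) | j. 1 \<le> j \<and> j \<le> n - 1}
     in \<lparr> pverts = {1..n} \<times> {1..m}, parcs = A \<union> A\<inverse> \<rparr>)"

text \<open>The requirements \<open>S \<subseteq> \<int>\<close> and \<open>\<star> : S \<times> S \<rightarrow> \<int>\<close> are expressed by the types; values of \<open>\<star>\<close>
  outside \<open>S\<close>, and of \<open>\<zeta>\<close> at integers not coprime to \<open>\<eta>\<close>, are irrelevant below.\<close>

definition arithmetic_structure ::
  "nat \<Rightarrow> int set \<Rightarrow> (int \<Rightarrow> nat) \<Rightarrow> (int \<Rightarrow> int \<Rightarrow> int) \<Rightarrow> bool" where
  "arithmetic_structure \<eta> S \<zeta> star \<longleftrightarrow> 0 < \<eta> \<and> \<zeta> \<in> {\<xi>. gcd \<xi> (int \<eta>) = 1} \<rightarrow> {0, 1}"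

definition induced_label ::
  "nat \<Rightarrow> (int \<Rightarrow> nat) \<Rightarrow> (int \<Rightarrow> int \<Rightarrow> int) \<Rightarrow> ('v \<Rightarrow> int) \<Rightarrow> 'v \<Rightarrow> 'v \<Rightarrow> nat" where
  "induced_label \<eta> \<zeta> star f a b =
    (if gcd (star (f a) (f b)) (int \<eta>) \<noteq> 1 \<or> \<zeta> (star (f a) (f b)) = 0 then 0 else 1)"

text \<open>The edges carrying label \<open>i\<close>, as unordered pairs, so that each edge is counted once.\<close>

definition labelled_edges ::
  "'v pair_pre_digraph \<Rightarrow> nat \<Rightarrow> (int \<Rightarrow> nat) \<Rightarrow> (int \<Rightarrow> int \<Rightarrow> int) \<Rightarrow> ('v \<Rightarrow> int) \<Rightarrow> nat \<Rightarrow> 'v set set" where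
  "labelled_edges G \<eta> \<zeta> star f i =
    {{a, b} | a b. (a, b) \<in> parcs G \<and> induced_label \<eta> \<zeta> star f a b = i}"

text \<open>The second conjunct says that the induced label is a function of the undirected edge;
  it matters only for a non-commutative \<open>\<star>\<close>.\<close>

definition arithmetic_cordial_labeling ::
  "'v pair_pre_digraph \<Rightarrow> nat \<Rightarrow> int set \<Rightarrow> (int \<Rightarrow> nat) \<Rightarrow> (int \<Rightarrow> int \<Rightarrow> int) \<Rightarrow> ('v \<Rightarrow> int) \<Rightarrow> bool" where
  "arithmetic_cordial_labeling G \<eta> S \<zeta> star f \<longleftrightarrow>
    bij_betw f (pverts G) S \<and>
    (\<forall>(a, b) \<in> parcs G. induced_label \<eta> \<zeta> star f a b = induced_label \<eta> \<zeta> star f b a) \<and>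
    \<bar>int (card (labelled_edges G \<eta> \<zeta> star f 0)) - int (card (labelled_edges G \<eta> \<zeta> star f 1))\<bar> \<le> 1"

definition arithmetic_cordial_graph ::
  "'v pair_pre_digraph \<Rightarrow> nat \<Rightarrow> int set \<Rightarrow> (int \<Rightarrow> nat) \<Rightarrow> (int \<Rightarrow> int \<Rightarrow> int) \<Rightarrow> bool" where
  "arithmetic_cordial_graph G \<eta> S \<zeta> star \<longleftrightarrow>
    arithmetic_structure \<eta> S \<zeta> star \<and>
    pair_graph G \<and> connected (with_proj G) \<and>
    (\<exists>f. arithmetic_cordial_labeling G \<eta> S \<zeta> star f)"

end

theory Submission
  imports Defs
begin

text \<open>
  Number the vertices consecutively, cycle after cycle: the \<open>k\<close>-th vertex of the \<open>i\<close>-th cycle gets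
  \<open>(i - 1) p + k\<close>. As \<open>\<zeta>\<close> depends only on residues, so does the label of an edge, and the edge from
  the \<open>k\<close>-th vertex of a cycle to its successor has sum \<open>2 k + 1\<close> modulo \<open>p\<close>; this includes the
  closing edge \<open>k = p\<close>, whose sum is \<open>1\<close>. Because \<open>p\<close> is odd, these sums run through every residue
  exactly once around each cycle (\<open>bij_betw_odd_numbers_mod\<close>). The nonzero residues are split evenly
  by \<open>\<zeta>\<close> and the residue \<open>0\<close> has label \<open>0\<close>, so each of the \<open>n\<close> cycles has exactly one more edge
  labelled \<open>0\<close> than edges labelled \<open>1\<close> (\<open>card_residue_label\<close>). Each of the \<open>n - 1\<close> links joins
  residues \<open>0\<close> and \<open>1\<close>, so its sum is \<open>1\<close> and its label is \<open>\<zeta> 1 = 1\<close>. The links therefore offset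
  the surplus of all cycles but one, and the two label counts differ by \<open>n - (n - 1) = 1\<close>.

  What remains is to count unordered edges without repetition, which is
  \<open>card_labelled_edges_snake\<close>, and to see that the snake is a connected simple graph.
\<close>

section \<open>The alternate cycle snake as a simple connected graph\<close>

definition cycle_edge :: "nat \<Rightarrow> nat \<times> nat \<Rightarrow> (nat \<times> nat) set" where
  "cycle_edge m = (\<lambda>(i, k). {(i, k), (i, k mod m + 1)})"

definition link_edge :: "nat \<Rightarrow> nat \<Rightarrow> (nat \<times> nat) set" where
  "link_edge m j = {(j, m), (j + 1, 1)}"

lemma pverts_snake: "pverts (alternate_cycle_snake n m) = {1..n} \<times> {1..m}"
  by (simp add: alternate_cycle_snake_def Let_def)

text \<open>Reading \<open>k mod m + 1\<close> as the cyclic successor of \<open>k\<close> merges the path edges and the closing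
  edge of each cycle into a single family indexed by the vertices.\<close>

lemma arc_snake_iff:
  assumes "m \<ge> 1"
  shows "(a, b) \<in> parcs (alternate_cycle_snake n m) \<longleftrightarrow>
    (\<exists>i k. i \<in> {1..n} \<and> k \<in> {1..m} \<and>
       ((a, b) = ((i, k), (i, k mod m + 1)) \<or> (b, a) = ((i, k), (i, k mod m + 1)))) \<or>
    (\<exists>j. j \<in> {1..<n} \<and>
       ((a, b) = ((j, m), (j + 1, 1)) \<or> (b, a) = ((j, m), (j + 1, 1))))"
    (is "?L \<longleftrightarrow> ?R")
proof -
  have cyc: "{((i, k), (i, k + 1)) | i k. 1 \<le> i \<and> i \<le> n \<and> 1 \<le> k \<and> k \<le> m - 1}
      \<union> {((i, m), (i, 1)) | i. 1 \<le> i \<and> i \<le> n}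
    = {((i, k), (i, k mod m + 1)) | i k. i \<in> {1..n} \<and> k \<in> {1..m}}" (is "?P \<union> ?C = ?Q")
  proof (intro set_eqI iffI)
    fix x assume "x \<in> ?P \<union> ?C"
    then show "x \<in> ?Q"
    proof
      assume "x \<in> ?P"
      then obtain i k where "x = ((i, k), (i, k + 1))" "i \<in> {1..n}" "1 \<le> k" "k \<le> m - 1"
        by auto
      moreover from this assms have "k mod m = k" "k \<in> {1..m}" by auto
      ultimately show ?thesis by force
    next
      assume "x \<in> ?C"
      then show ?thesis using assms by force
    qed
  next
    fix x assume "x \<in> ?Q"
    then obtain i k where x: "x = ((i, k), (i, k mod m + 1))" "i \<in> {1..n}" "k \<in> {1..m}"
      by auto
    show "x \<in> ?P \<union> ?C"
    proof (cases "k = m")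
      case True
      then show ?thesis using x by auto
    next
      case False
      then have "k mod m = k" "k \<le> m - 1" using x by auto
      then show ?thesis using x by auto
    qed
  qed
  have links: "{((j, m), (j + 1, 1)) | j. 1 \<le> j \<and> j \<le> n - 1}
      = {((j, m), (j + 1, 1)) | j. j \<in> {1..<n}}"
    by force
  show ?thesis
    unfolding alternate_cycle_snake_def Let_def cyc links by simp blast
qed

lemma mod_add_1_in_range:
  fixes k m :: nat
  assumes "m \<ge> 1"
  shows "k mod m + 1 \<in> {1..m}"
  using assms by (simp add: Suc_leI)

lemma mod_add_1_neq:
  fixes k m :: nat
  assumes "m \<ge> 2" "k \<in> {1..m}"
  shows "k mod m + 1 \<noteq> k"
proof (cases "k = m")
  case False
  then have "k mod m = k" using assms by auto
  then show ?thesis by simp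
qed (use assms in simp)

text \<open>Length at least \<open>3\<close> is what keeps the cyclic successor from being an involution: in a cycle
  of length \<open>2\<close> the edges leaving the two vertices would coincide.\<close>

lemma inj_on_cycle_edge:
  assumes "m \<ge> 3"
  shows "inj_on (cycle_edge m) ({1..n} \<times> {1..m})"
proof (rule inj_onI, clarify)
  fix i k i' k'
  assume k: "k \<in> {1..m}" "k' \<in> {1..m}" and eq: "cycle_edge m (i, k) = cycle_edge m (i', k')"
  have "i = i'" using eq by (auto simp: cycle_edge_def doubleton_eq_iff)
  moreover have "k = k'"
  proof (rule ccontr)
    assume "k \<noteq> k'"
    then have e: "k = k' mod m + 1" "k' = k mod m + 1"
      using eq by (auto simp: cycle_edge_def doubleton_eq_iff)
    have succ: "j mod m + 1 = (if j = m then 1 else j + 1)" if "j \<in> {1..m}" for j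
      using that by auto
    have "k = (if k' = m then 1 else k' + 1)" "k' = (if k = m then 1 else k + 1)"
      using e unfolding succ[OF k(1)] succ[OF k(2)] .
    then show False using assms by presburger
  qed
  ultimately show "i = i' \<and> k = k'" by simp
qed

lemma inj_link_edge: "inj (link_edge m)"
  by (rule injI) (auto simp: link_edge_def doubleton_eq_iff)

lemma cycle_edge_neq_link_edge: "cycle_edge m v \<noteq> link_edge m j"
  by (cases v) (auto simp: cycle_edge_def link_edge_def doubleton_eq_iff)

lemma pair_graph_snake:
  assumes "m \<ge> 2"
  shows "pair_graph (alternate_cycle_snake n m)"
proof -
  let ?G = "alternate_cycle_snake n m"
  have m: "m \<ge> 1" using assms by simp
  have verts: "a \<in> pverts ?G \<and> b \<in> pverts ?G \<and> a \<noteq> b \<and> (b, a) \<in> parcs ?G"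
    if ab: "(a, b) \<in> parcs ?G" for a b
  proof -
    have "a \<in> pverts ?G \<and> b \<in> pverts ?G \<and> a \<noteq> b"
      using ab m mod_add_1_in_range[OF m] mod_add_1_neq[OF assms]
      unfolding arc_snake_iff[OF m] pverts_snake by fastforce
    moreover have "(b, a) \<in> parcs ?G"
      using ab unfolding arc_snake_iff[OF m] by blast
    ultimately show ?thesis by blast
  qed
  have "finite (pverts ?G)" by (simp add: pverts_snake)
  moreover have "parcs ?G \<subseteq> pverts ?G \<times> pverts ?G" using verts by auto
  ultimately have "finite (parcs ?G)" by (meson finite_SigmaI finite_subset)
  then show ?thesis
    using verts \<open>finite (pverts ?G)\<close>
    by unfold_locales (auto simp: symmetric_def intro: symI)
qed

lemma connected_snake:
  assumes "m \<ge> 2" "n \<ge> 1"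
  shows "connected (with_proj (alternate_cycle_snake n m))"
proof -
  let ?G = "alternate_cycle_snake n m"
  interpret pair_graph ?G using pair_graph_snake[OF assms(1)] .
  have m: "m \<ge> 1" using assms by simp
  \<comment> \<open>Within a cycle the path edges suffice; the last vertex of a cycle leads to the next cycle.\<close>
  have along: "(i, 1) \<rightarrow>\<^sup>*\<^bsub>with_proj ?G\<^esub> (i, k)" if "k \<ge> 1" "k \<le> m" "i \<in> {1..n}" for i k
    using that
  proof (induction k rule: nat_induct_at_least)
    case base
    then show ?case by (intro reachable_refl) (simp add: pverts_snake)
  next
    case (Suc k)
    then have "((i, k), (i, Suc k)) \<in> parcs ?G"
      unfolding arc_snake_iff[OF m]
      by (intro disjI1 exI[of _ i] exI[of _ k]) auto
    with Suc show ?case by (auto intro: reachable_adj_trans)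
  qed
  have start: "(1, 1) \<rightarrow>\<^sup>*\<^bsub>with_proj ?G\<^esub> (i, 1)" if "i \<ge> 1" "i \<le> n" for i
    using that
  proof (induction i rule: nat_induct_at_least)
    case base
    then show ?case using m by (intro reachable_refl) (simp add: pverts_snake)
  next
    case (Suc i)
    then have "((i, m), (Suc i, 1)) \<in> parcs ?G"
      unfolding arc_snake_iff[OF m]
      by (intro disjI2 exI[of _ i]) auto
    moreover have "(1, 1) \<rightarrow>\<^sup>*\<^bsub>with_proj ?G\<^esub> (i, m)"
      using Suc along[of m i] m by (auto intro: reachable_trans)
    ultimately show ?case by (auto intro: reachable_adj_trans)
  qed
  have all: "(1, 1) \<rightarrow>\<^sup>*\<^bsub>with_proj ?G\<^esub> v" if "v \<in> pverts ?G" for v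
    using that start[of "fst v"] along[of "snd v" "fst v"]
    by (cases v) (auto simp: pverts_snake intro: reachable_trans)
  show ?thesis
    unfolding connected_def
  proof (rule strongly_connectedI)
    show "verts (with_proj (mk_symmetric (with_proj ?G))) \<noteq> {}"
      using assms by (simp add: pverts_snake)
  next
    fix u v
    assume "u \<in> verts (with_proj (mk_symmetric (with_proj ?G)))"
      "v \<in> verts (with_proj (mk_symmetric (with_proj ?G)))"
    then have "(1, 1) \<rightarrow>\<^sup>*\<^bsub>with_proj ?G\<^esub> u" "(1, 1) \<rightarrow>\<^sup>*\<^bsub>with_proj ?G\<^esub> v"
      using all by simp_all
    then have "u \<rightarrow>\<^sup>*\<^bsub>with_proj ?G\<^esub> v"
      using symmetric_reachable' reachable_trans by blast
    then show "u \<rightarrow>\<^sup>*\<^bsub>with_proj (mk_symmetric (with_proj ?G))\<^esub> v"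
      by (rule reachable_mk_symmetricI)
  qed
qed

text \<open>For a commutative operation the label does not depend on the orientation of an edge, so the
  edges with a given label can be counted through one oriented representative each: one per vertex
  for the cycles and one per index \<open>j < n\<close> for the links.\<close>

lemma card_labelled_edges_snake:
  fixes star :: "int \<Rightarrow> int \<Rightarrow> int"
  assumes "m \<ge> 3" and comm: "\<And>x y. star x y = star y x"
  shows "card (labelled_edges (alternate_cycle_snake n m) \<eta> \<zeta> star f c) =
    card {(i, k) \<in> {1..n} \<times> {1..m}. induced_label \<eta> \<zeta> star f (i, k) (i, k mod m + 1) = c} +
    card {j \<in> {1..<n}. induced_label \<eta> \<zeta> star f (j, m) (j + 1, 1) = c}"
    (is "card ?E = card ?C + card ?L")
proof -
  have m: "m \<ge> 1" using assms by simp
  have sym: "induced_label \<eta> \<zeta> star f a b = induced_label \<eta> \<zeta> star f b a" for a b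
    by (simp add: induced_label_def comm)
  have "?E = cycle_edge m ` ?C \<union> link_edge m ` ?L"
  proof (intro set_eqI iffI)
    fix e assume "e \<in> ?E"
    then obtain a b where e: "e = {a, b}" "(a, b) \<in> parcs (alternate_cycle_snake n m)"
      "induced_label \<eta> \<zeta> star f a b = c"
      by (auto simp: labelled_edges_def)
    from e(2) consider (cyc) i k where "i \<in> {1..n}" "k \<in> {1..m}"
        "(a, b) = ((i, k), (i, k mod m + 1)) \<or> (b, a) = ((i, k), (i, k mod m + 1))"
      | (link) j where "j \<in> {1..<n}"
        "(a, b) = ((j, m), (j + 1, 1)) \<or> (b, a) = ((j, m), (j + 1, 1))"
      unfolding arc_snake_iff[OF m] by blast
    then show "e \<in> cycle_edge m ` ?C \<union> link_edge m ` ?L"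
    proof cases
      case cyc
      then have "e = cycle_edge m (i, k)" using e(1) by (auto simp: cycle_edge_def)
      moreover have "(i, k) \<in> ?C" using cyc e(3) sym by auto
      ultimately show ?thesis by blast
    next
      case link
      then have "e = link_edge m j" using e(1) by (auto simp: link_edge_def)
      moreover have "j \<in> ?L" using link e(3) sym by auto
      ultimately show ?thesis by blast
    qed
  next
    fix e assume "e \<in> cycle_edge m ` ?C \<union> link_edge m ` ?L"
    then show "e \<in> ?E"
    proof
      assume "e \<in> cycle_edge m ` ?C"
      then obtain i k where "(i, k) \<in> ?C" "e = {(i, k), (i, k mod m + 1)}"
        by (auto simp: cycle_edge_def)
      moreover from this
      have "((i, k), (i, k mod m + 1)) \<in> parcs (alternate_cycle_snake n m)"
        unfolding arc_snake_iff[OF m] by blast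
      ultimately show ?thesis unfolding labelled_edges_def by blast
    next
      assume "e \<in> link_edge m ` ?L"
      then obtain j where "j \<in> ?L" "e = {(j, m), (j + 1, 1)}"
        by (auto simp: link_edge_def)
      moreover from this
      have "((j, m), (j + 1, 1)) \<in> parcs (alternate_cycle_snake n m)"
        unfolding arc_snake_iff[OF m] by blast
      ultimately show ?thesis unfolding labelled_edges_def by blast
    qed
  qed
  moreover have "cycle_edge m ` ?C \<inter> link_edge m ` ?L = {}"
    using cycle_edge_neq_link_edge by blast
  moreover have "finite ?C" by (rule finite_subset[of _ "{1..n} \<times> {1..m}"]) auto
  moreover have "finite ?L" by simp
  moreover have "inj_on (cycle_edge m) ?C"
    by (rule inj_on_subset[OF inj_on_cycle_edge[OF assms(1), of n]]) auto
  moreover have "inj_on (link_edge m) ?L" by (rule inj_on_subset[OF inj_link_edge]) simp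
  ultimately show ?thesis by (simp add: card_Un_disjoint card_image)
qed

section \<open>Labels as a function of the residue\<close>

definition residue_label :: "nat \<Rightarrow> (int \<Rightarrow> nat) \<Rightarrow> int \<Rightarrow> nat" where
  "residue_label p \<zeta> x = (if gcd x (int p) \<noteq> 1 \<or> \<zeta> x = 0 then 0 else 1)"

lemma induced_label_eq_residue_label:
  "induced_label p \<zeta> star f a b = residue_label p \<zeta> (star (f a) (f b))"
  by (simp add: induced_label_def residue_label_def)

lemma residue_label_mod:
  assumes "\<And>\<theta>1 \<theta>2 :: int. gcd \<theta>1 (int p) = 1 \<Longrightarrow> gcd \<theta>2 (int p) = 1 \<Longrightarrow>
           [\<theta>1 = \<theta>2] (mod int p) \<Longrightarrow> \<zeta> \<theta>1 = \<zeta> \<theta>2"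
  shows "residue_label p \<zeta> (x mod int p) = residue_label p \<zeta> x"
proof -
  have cong: "[x mod int p = x] (mod int p)" by (simp only: cong_def mod_mod_trivial)
  then have "gcd (x mod int p) (int p) = gcd x (int p)" by (rule cong_gcd_eq)
  moreover have "\<zeta> (x mod int p) = \<zeta> x"
    if "gcd (x mod int p) (int p) = 1" "gcd x (int p) = 1"
    using assms[OF that cong] .
  ultimately show ?thesis unfolding residue_label_def by metis
qed

text \<open>Since \<open>2\<close> is invertible modulo an odd \<open>p\<close>, the numbers \<open>2 k + 1\<close> for \<open>k = 1, \<dots>, p\<close> form a
  complete residue system.\<close>

lemma bij_betw_odd_numbers_mod:
  assumes "odd p"
  shows "bij_betw (\<lambda>k. (2 * int k + 1) mod int p) {1..p} {0..<int p}"
proof -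
  have p: "p > 0" using assms by (rule odd_pos)
  have inj: "inj_on (\<lambda>k. (2 * int k + 1) mod int p) {1..p}"
  proof (rule inj_onI)
    fix k l assume kl: "k \<in> {1..p}" "l \<in> {1..p}"
      and "(2 * int k + 1) mod int p = (2 * int l + 1) mod int p"
    then have "[2 * int k + 1 = 2 * int l + 1] (mod int p)" by (simp only: cong_def)
    then have "[2 * int k = 2 * int l] (mod int p)" by (simp only: cong_add_rcancel)
    moreover have "coprime 2 (int p)" using assms by simp
    ultimately have "[int k = int l] (mod int p)" by (simp only: cong_mult_lcancel)
    then have "int p dvd int k - int l" by (simp add: cong_iff_dvd_diff)
    moreover have "\<bar>int k - int l\<bar> < int p" using kl by auto
    ultimately have "int k - int l = 0" using dvd_imp_le_int[of "int k - int l" "int p"] by linarith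
    then show "k = l" by simp
  qed
  have "(\<lambda>k. (2 * int k + 1) mod int p) ` {1..p} \<subseteq> {0..<int p}" using p by auto
  moreover have "card ((\<lambda>k. (2 * int k + 1) mod int p) ` {1..p}) = card {0..<int p}"
    using card_image[OF inj] by simp
  ultimately show ?thesis using inj by (simp add: bij_betw_def card_subset_eq)
qed

text \<open>Counting a label around a cycle, where the sums are \<open>2 k + 1\<close>, thus amounts to counting it over
  all residues.\<close>

lemma card_periodic_odd_numbers:
  fixes g :: "int \<Rightarrow> 'a"
  assumes "odd p" and periodic: "\<And>x. g (x mod int p) = g x"
  shows "card {k \<in> {1..p}. g (2 * int k + 1) = c} = card {r \<in> {0..<int p}. g r = c}"
proof (rule bij_betw_same_card, rule bij_betw_Collect)
  show "bij_betw (\<lambda>k. (2 * int k + 1) mod int p) {1..p} {0..<int p}"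
    using assms(1) by (rule bij_betw_odd_numbers_mod)
  show "g ((2 * int k + 1) mod int p) = c \<longleftrightarrow> g (2 * int k + 1) = c" for k
    by (simp only: periodic)
qed

lemma gcd_prime_eq_1:
  fixes a :: int
  assumes "prime p" "1 \<le> a" "a \<le> int p - 1"
  shows "gcd a (int p) = 1"
proof -
  have "\<not> int p dvd a" using assms zdvd_not_zless by auto
  moreover have "prime (int p)" using assms by simp
  ultimately show ?thesis
    by (metis coprime_iff_gcd_eq_1 gcd.commute prime_imp_coprime)
qed

text \<open>The residue \<open>0\<close> always carries label \<open>0\<close>; that is the whole imbalance of a complete residue
  system when \<open>\<zeta>\<close> is balanced on the nonzero residues.\<close>

lemma card_residue_label:
  assumes "prime p" "\<zeta> \<in> {\<xi>. gcd \<xi> (int p) = 1} \<rightarrow> {0, 1}"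
  shows "card {r \<in> {0..<int p}. residue_label p \<zeta> r = 1} =
      card {a :: int. \<zeta> a = 1 \<and> 1 \<le> a \<and> a \<le> int p - 1}"
    and "card {r \<in> {0..<int p}. residue_label p \<zeta> r = 0} =
      card {a :: int. \<zeta> a = 0 \<and> 1 \<le> a \<and> a \<le> int p - 1} + 1"
proof -
  have p: "p > 1" using assms(1) by (rule prime_gt_1_nat)
  have zero: "residue_label p \<zeta> 0 = 0" using p by (simp add: residue_label_def)
  have nonzero: "residue_label p \<zeta> a = \<zeta> a" if "1 \<le> a" "a \<le> int p - 1" for a
  proof -
    have g: "gcd a (int p) = 1" using gcd_prime_eq_1[OF assms(1) that] .
    then have "\<zeta> a \<in> {0, 1}" by (intro funcset_mem[OF assms(2)]) simp
    then show ?thesis using g by (auto simp: residue_label_def)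
  qed
  have mem: "r \<in> {0..<int p} \<longleftrightarrow> r = 0 \<or> (1 \<le> r \<and> r \<le> int p - 1)" for r
    using p by auto
  have "{r \<in> {0..<int p}. residue_label p \<zeta> r = 1} =
      {a. \<zeta> a = 1 \<and> 1 \<le> a \<and> a \<le> int p - 1}"
    unfolding mem using zero nonzero by auto
  then show "card {r \<in> {0..<int p}. residue_label p \<zeta> r = 1} =
      card {a :: int. \<zeta> a = 1 \<and> 1 \<le> a \<and> a \<le> int p - 1}" by simp
  have "{r \<in> {0..<int p}. residue_label p \<zeta> r = 0} =
      insert 0 {a. \<zeta> a = 0 \<and> 1 \<le> a \<and> a \<le> int p - 1}"
    unfolding mem using zero nonzero by auto
  moreover have "finite {a :: int. \<zeta> a = 0 \<and> 1 \<le> a \<and> a \<le> int p - 1}"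
    by (rule finite_subset[of _ "{1..int p - 1}"]) auto
  ultimately show "card {r \<in> {0..<int p}. residue_label p \<zeta> r = 0} =
      card {a :: int. \<zeta> a = 0 \<and> 1 \<le> a \<and> a \<le> int p - 1} + 1" by simp
qed

section \<open>The consecutive labeling\<close>

definition consecutive_labeling :: "nat \<Rightarrow> nat \<times> nat \<Rightarrow> int" where
  "consecutive_labeling m = (\<lambda>(i, k). (int i - 1) * int m + int k)"

lemma bij_betw_consecutive_labeling:
  "bij_betw (consecutive_labeling m) ({1..n} \<times> {1..m}) {1..int (n * m)}"
proof -
  let ?f = "consecutive_labeling m"
  \<comment> \<open>Euclidean division of the label minus one recovers the cycle and the position in it; the shift
    makes the positions range over \<open>0, \<dots>, m - 1\<close> instead of \<open>1, \<dots>, m\<close>.\<close>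
  have div_mod: "(?f (i, k) - 1) div int m = int i - 1" "(?f (i, k) - 1) mod int m = int k - 1"
    if "k \<in> {1..m}" for i k
  proof -
    have eq: "?f (i, k) - 1 = (int k - 1) + (int i - 1) * int m"
      by (simp add: consecutive_labeling_def)
    have k: "0 \<le> int k - 1" "int k - 1 < int m" using that by auto
    then show "(?f (i, k) - 1) div int m = int i - 1" unfolding eq by simp
    show "(?f (i, k) - 1) mod int m = int k - 1" unfolding eq using k by simp
  qed
  have inj: "inj_on ?f ({1..n} \<times> {1..m})"
  proof (rule inj_onI, clarify)
    fix i k i' k'
    assume "k \<in> {1..m}" "k' \<in> {1..m}" "?f (i, k) = ?f (i', k')"
    then show "i = i' \<and> k = k'" using div_mod[of k i] div_mod[of k' i'] by simp
  qed
  have "?f ` ({1..n} \<times> {1..m}) \<subseteq> {1..int (n * m)}"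
  proof clarify
    fix i k assume ik: "i \<in> {1..n}" "k \<in> {1..m}"
    have "(int i - 1) * int m \<ge> 0" using ik by simp
    moreover have "(int i - 1) * int m \<le> (int n - 1) * int m"
      using ik by (intro mult_right_mono) auto
    ultimately have "1 \<le> ?f (i, k)" "?f (i, k) \<le> (int n - 1) * int m + int m"
      using ik unfolding consecutive_labeling_def prod.case atLeastAtMost_iff by linarith+
    then show "?f (i, k) \<in> {1..int (n * m)}" by (simp add: algebra_simps)
  qed
  moreover have "card (?f ` ({1..n} \<times> {1..m})) = card {1..int (n * m)}"
    using card_image[OF inj] by (simp add: card_cartesian_product nat_mult_distrib)
  ultimately show ?thesis using inj by (simp add: bij_betw_def card_subset_eq)
qed

lemma consecutive_labeling_cong: "[consecutive_labeling m (i, k) = int k] (mod int m)"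
  by (simp add: consecutive_labeling_def cong_def)

text \<open>The closing edge obeys the same formula as the path edges because the first vertex, of residue
  \<open>1\<close>, looks modulo \<open>m\<close> like a successor \<open>m + 1\<close> of the last one.\<close>

lemma cycle_edge_sum_cong:
  "[consecutive_labeling m (i, k) + consecutive_labeling m (i, k mod m + 1)
    = 2 * int k + 1] (mod int m)"
proof -
  have "[int (k mod m + 1) = int k + 1] (mod int m)"
    by (simp add: cong_def zmod_int mod_add_left_eq add.commute[of 1])
  then have "[consecutive_labeling m (i, k mod m + 1) = int k + 1] (mod int m)"
    using consecutive_labeling_cong cong_trans by blast
  then have "[consecutive_labeling m (i, k) + consecutive_labeling m (i, k mod m + 1)
    = int k + (int k + 1)] (mod int m)"
    by (intro cong_add consecutive_labeling_cong)
  then show ?thesis by (simp add: algebra_simps)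
qed

lemma link_edge_sum_cong:
  "[consecutive_labeling m (j, m) + consecutive_labeling m (j + 1, 1) = 1] (mod int m)"
proof -
  have "[consecutive_labeling m (j, m) + consecutive_labeling m (j + 1, 1) = int m + int 1]
      (mod int m)"
    by (intro cong_add consecutive_labeling_cong)
  then show ?thesis by (simp add: cong_def)
qed

theorem theorem4p2:
  fixes p n :: nat and \<zeta> :: "int \<Rightarrow> nat"
  assumes "prime p" and "odd p" and "p \<ge> 3" and "n \<ge> 2"
    and "\<zeta> \<in> {\<xi>. gcd \<xi> (int p) = 1} \<rightarrow> {0, 1}"
    and "\<And>\<theta>1 \<theta>2 :: int. gcd \<theta>1 (int p) = 1 \<Longrightarrow> gcd \<theta>2 (int p) = 1 \<Longrightarrow>
           [\<theta>1 = \<theta>2] (mod int p) \<Longrightarrow> \<zeta> \<theta>1 = \<zeta> \<theta>2"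
    and "card {a :: int. \<zeta> a = 0 \<and> 1 \<le> a \<and> a \<le> int p - 1} = (p - 1) div 2"
    and "card {a :: int. \<zeta> a = 1 \<and> 1 \<le> a \<and> a \<le> int p - 1} = (p - 1) div 2"
    and "\<zeta> 1 = 1"
  shows "arithmetic_cordial_graph (alternate_cycle_snake n p) p {1..int (n * p)} \<zeta> (+)"
proof -
  let ?G = "alternate_cycle_snake n p" and ?f = "consecutive_labeling p"
  let ?E = "labelled_edges ?G p \<zeta> (+) ?f"
  define h where "h = (p - 1) div 2"
  have periodic: "residue_label p \<zeta> (x mod int p) = residue_label p \<zeta> x" for x
    using assms(6) by (rule residue_label_mod)
  have label_cong: "residue_label p \<zeta> x = residue_label p \<zeta> y" if "[x = y] (mod int p)" for x y
    using that periodic[of x] periodic[of y] unfolding cong_def by metis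
  have cyc_label: "induced_label p \<zeta> (+) ?f (i, k) (i, k mod p + 1)
      = residue_label p \<zeta> (2 * int k + 1)" for i k
    unfolding induced_label_eq_residue_label by (rule label_cong[OF cycle_edge_sum_cong])
  have "residue_label p \<zeta> 1 = 1" using assms(9) by (simp add: residue_label_def)
  then have link_label: "induced_label p \<zeta> (+) ?f (j, p) (j + 1, 1) = 1" for j
    unfolding induced_label_eq_residue_label using label_cong[OF link_edge_sum_cong] by simp
  have card_E: "card (?E c) = n * card {r \<in> {0..<int p}. residue_label p \<zeta> r = c} +
      card {j \<in> {1..<n}. 1 = c}" for c
  proof -
    have "{(i, k) \<in> {1..n} \<times> {1..p}. residue_label p \<zeta> (2 * int k + 1) = c} =
        {1..n} \<times> {k \<in> {1..p}. residue_label p \<zeta> (2 * int k + 1) = c}" by auto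
    then have "card {(i, k) \<in> {1..n} \<times> {1..p}. residue_label p \<zeta> (2 * int k + 1) = c} =
        n * card {r \<in> {0..<int p}. residue_label p \<zeta> r = c}"
      using card_periodic_odd_numbers[of p "residue_label p \<zeta>", OF assms(2) periodic]
      by (simp only: card_cartesian_product card_atLeastAtMost diff_Suc_1)
    then show ?thesis
      using card_labelled_edges_snake[of p "(+)" n p \<zeta> ?f c] assms(3)
      unfolding cyc_label link_label by (simp only: add.commute)
  qed
  have no_link: "{j \<in> {1..<n}. 1 = (0::nat)} = {}" by simp
  have all_links: "{j \<in> {1..<n}. 1 = (1::nat)} = {1..<n}" by auto
  have "card (?E 0) = n * (h + 1)" "card (?E 1) = n * h + (n - 1)"
    using card_E[of 0] card_E[of 1] card_residue_label[OF assms(1,5)] assms(7,8)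
    unfolding no_link all_links by (simp_all add: h_def)
  \<comment> \<open>The difference is \<open>n - (n - 1)\<close>: one surplus edge labelled \<open>0\<close> per cycle, against the links.\<close>
  then have "\<bar>int (card (?E 0)) - int (card (?E 1))\<bar> \<le> 1"
    using assms(4) by (simp add: algebra_simps of_nat_diff)
  moreover have "bij_betw ?f (pverts ?G) {1..int (n * p)}"
    unfolding pverts_snake by (rule bij_betw_consecutive_labeling)
  moreover have "\<forall>(a, b) \<in> parcs ?G.
      induced_label p \<zeta> (+) ?f a b = induced_label p \<zeta> (+) ?f b a"
    by (simp add: induced_label_eq_residue_label add.commute)
  ultimately have "arithmetic_cordial_labeling ?G p {1..int (n * p)} \<zeta> (+) ?f"
    unfolding arithmetic_cordial_labeling_def by blast
  moreover have "arithmetic_structure p {1..int (n * p)} \<zeta> (+)"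
    using assms(3,5) by (simp add: arithmetic_structure_def)
  moreover have "pair_graph ?G" using assms(3) by (intro pair_graph_snake) simp
  moreover have "connected (with_proj ?G)" using assms(3,4) by (intro connected_snake) simp_all
  ultimately show ?thesis unfolding arithmetic_cordial_graph_def by blast
qed

end
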